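(* Let $V=\{1,\dots,n\}$, let $f_1,\dots,f_l:2^V\to\mathbb R_{\ge0}$ be monotone submodular functions with $f_i(\emptyset)=0$, and let $\mathcal C\subseteq2^V$ be a nonempty constraint family that can be expressed through a polytope $$\hat{\mathcal P}_{\mathcal C}=\Big\{x\in[0,1]^n:\ \sum_{i\in W}x_i\ge b_W\ \text{ for all } W\in\mathcal W\Big\}$$ for a family $\mathcal W$ of subsets of $V$ and integers $1\le b_W\le|W|$. Then the continuous relaxation scheme for Robust-SubMin, $\min_{X\in\mathcal C}\max_{i=1,\dots,l}f_i(X)$, achieves an approximation guarantee of $\max_{W\in\mathcal W}(|W|-b_W+1)$; that is, its output $\hat X\in\mathcal C$ satisfies $$\max_i f_i(\hat X)\ \le\ \max_{W\in\mathcal W}\big(|W|-b_W+1\big)\cdot\min_{X\in\mathcal C}\max_i f_i(X).$$ If moreover the sets in $\mathcal W$ are pairwise disjoint, then the integrality gap matches this approximation bound: the supremum, over all tuples $(f_1,\dots,f_l)$ of monotone submodular functions $f_i:2^V\to\mathbb R_{\ge0}$ with $f_i(\emptyset)=0$ for which the denominator is positive, of $$\frac{\min_{X\in\mathcal C}\max_i f_i(X)}{\min_{x\in\hat{\mathcal P}_{\mathcal C}}\max_i\hat f_i(x)}$$ equals $\max_{W\in\mathcal W}(|W|-b_W+1)$, where $\hat f_i$ is the Lovász extension of $f_i$.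
   Context: A set function $f$ is submodular if $f(S)+f(T)\ge f(S\cup T)+f(S\cap T)$ for all $S,T\subseteq V$, and monotone if $f(S)\le f(T)$ for $S\subseteq T$. For $x\in[0,1]^n$ let $\sigma_x$ be an ordering of $V$ with $x(\sigma_x(1))\ge\dots\ge x(\sigma_x(n))$; the Lovász extension is $\hat f(x)=\sum_{i=1}^n x(\sigma_x(i))\,[f(S_i)-f(S_{i-1})]$, $S_i=\{\sigma_x(1),\dots,\sigma_x(i)\}$, $S_0=\emptyset$; it is convex for submodular $f$. Let $\hat{\mathcal C}=\{Y\subseteq V: X\subseteq Y\text{ for some }X\in\mathcal C\}$ be the up-monotone closure of $\mathcal C$. "$\mathcal C$ can be expressed through $\hat{\mathcal P}_{\mathcal C}$" means that the $0/1$ vectors in $\hat{\mathcal P}_{\mathcal C}$ are exactly the indicator vectors of the sets in $\hat{\mathcal C}$. Continuous relaxation scheme: compute a minimizer $\hat x$ of the convex function $\max_i\hat f_i(x)$ over $x\in\hat{\mathcal P}_{\mathcal C}$; order the elements by $\sigma_{\hat x}$ and let $X_k=\{\sigma_{\hat x}(1),\dots,\sigma_{\hat x}(k)\}$; take the smallest $k$ with $X_k\in\hat{\mathcal C}$, and output a set $\hat X\in\mathcal C$ with $\hat X\subseteq X_k$. *)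

theory Defs
  imports "HOL-Analysis.Analysis"
begin

text \<open>
  The ground set \<open>V\<close> is the universe of a finite type \<open>'v\<close>, so that \<open>n = CARD('v)\<close>.
  Monotonicity of set functions is the library's \<open>mono\<close> with respect to inclusion.
\<close>

definition submodular :: "('v set \<Rightarrow> real) \<Rightarrow> bool" where
  "submodular f \<longleftrightarrow> (\<forall>S T. f (S \<union> T) + f (S \<inter> T) \<le> f S + f T)"

definition normalized_mono_submodular :: "('v set \<Rightarrow> real) \<Rightarrow> bool" where
  "normalized_mono_submodular f \<longleftrightarrow>
     (\<forall>S. 0 \<le> f S) \<and> mono f \<and> submodular f \<and> f {} = 0"

definition decreasing_ordering :: "real ^ 'v::finite \<Rightarrow> (nat \<Rightarrow> 'v) \<Rightarrow> bool" where
  "decreasing_ordering x \<sigma> \<longleftrightarrow>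
     bij_betw \<sigma> {1..CARD('v)} UNIV \<and>
     (\<forall>i\<in>{1..CARD('v)}. \<forall>j\<in>{1..CARD('v)}. i \<le> j \<longrightarrow> x $ \<sigma> j \<le> x $ \<sigma> i)"

text \<open>
  The ordering is not unique when \<open>x\<close> has ties; the value of the Lovasz extension does
  not depend on the choice.
\<close>

definition lovasz_extension :: "('v::finite set \<Rightarrow> real) \<Rightarrow> real ^ 'v \<Rightarrow> real" where
  "lovasz_extension f x =
     (let \<sigma> = (SOME \<sigma>. decreasing_ordering x \<sigma>) in
      \<Sum>i = 1..CARD('v). x $ \<sigma> i * (f (\<sigma> ` {1..i}) - f (\<sigma> ` {1..i - 1})))"

definition up_closure :: "'v set set \<Rightarrow> 'v set set" where
  "up_closure C = {Y. \<exists>X\<in>C. X \<subseteq> Y}"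

definition covering_polytope :: "'v set set \<Rightarrow> ('v set \<Rightarrow> int) \<Rightarrow> (real ^ 'v::finite) set" where
  "covering_polytope \<W> b =
     {x. (\<forall>i. 0 \<le> x $ i \<and> x $ i \<le> 1) \<and>
         (\<forall>W\<in>\<W>. real_of_int (b W) \<le> (\<Sum>i\<in>W. x $ i))}"

definition indicator_vec :: "'v set \<Rightarrow> real ^ 'v::finite" where
  "indicator_vec S = (\<chi> i. indicator S i)"

definition expressed_through :: "'v set set \<Rightarrow> (real ^ 'v::finite) set \<Rightarrow> bool" where
  "expressed_through C P \<longleftrightarrow>
     {x \<in> P. \<forall>i. x $ i = 0 \<or> x $ i = 1} = indicator_vec ` up_closure C"

definition robust_cost :: "nat \<Rightarrow> (nat \<Rightarrow> 'v set \<Rightarrow> real) \<Rightarrow> 'v set \<Rightarrow> real" where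
  "robust_cost l f X = (MAX i\<in>{1..l}. f i X)"

definition relaxed_cost :: "nat \<Rightarrow> (nat \<Rightarrow> 'v::finite set \<Rightarrow> real) \<Rightarrow> real ^ 'v \<Rightarrow> real" where
  "relaxed_cost l f x = (MAX i\<in>{1..l}. lovasz_extension (f i) x)"

definition robust_opt ::
    "nat \<Rightarrow> (nat \<Rightarrow> 'v::finite set \<Rightarrow> real) \<Rightarrow> 'v set set \<Rightarrow> real" where
  "robust_opt l f C = (MIN X\<in>C. robust_cost l f X)"

definition relaxed_opt ::
    "nat \<Rightarrow> (nat \<Rightarrow> 'v::finite set \<Rightarrow> real) \<Rightarrow> (real ^ 'v) set \<Rightarrow> real" where
  "relaxed_opt l f P = (INF x\<in>P. relaxed_cost l f x)"

text \<open>
  The scheme is nondeterministic in the minimizer \<open>x\<close>, the tie-breaking of the ordering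
  \<open>\<sigma>\<close>, and the final choice of a feasible subset. The predicate holds of every set that
  some run of the scheme may output.
\<close>

definition relaxation_scheme_output ::
    "nat \<Rightarrow> (nat \<Rightarrow> 'v::finite set \<Rightarrow> real) \<Rightarrow> 'v set set \<Rightarrow> (real ^ 'v) set \<Rightarrow> 'v set \<Rightarrow> bool" where
  "relaxation_scheme_output l f C P X \<longleftrightarrow>
     (\<exists>x \<sigma> k. is_arg_min (relaxed_cost l f) (\<lambda>x. x \<in> P) x \<and>
        decreasing_ordering x \<sigma> \<and>
        k \<le> CARD('v) \<and> \<sigma> ` {1..k} \<in> up_closure C \<and>
        (\<forall>j<k. \<sigma> ` {1..j} \<notin> up_closure C) \<and>
        X \<in> C \<and> X \<subseteq> \<sigma> ` {1..k})"

definition approx_factor :: "'v set set \<Rightarrow> ('v set \<Rightarrow> int) \<Rightarrow> int" where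
  "approx_factor \<W> b = (MAX W\<in>\<W>. int (card W) - b W + 1)"

text \<open>
  The supremum is taken in the extended reals, where an empty or unbounded set of ratios
  gives an infinite value.
\<close>

definition integrality_gap :: "nat \<Rightarrow> 'v::finite set set \<Rightarrow> (real ^ 'v) set \<Rightarrow> ereal" where
  "integrality_gap l C P =
     (SUP f\<in>{f. (\<forall>i\<in>{1..l}. normalized_mono_submodular (f i)) \<and> 0 < relaxed_opt l f P}.
        ereal (robust_opt l f C / relaxed_opt l f P))"

end

theory Submission
  imports Defs
begin

text \<open>
  Along an ordering of the ground set, the marginals of a monotone submodular \<open>f\<close> form a nonnegative
  vector dominated by \<open>f\<close>, and the Lovasz extension at \<open>x\<close> is the maximum over all orderings of its
  inner product with \<open>x\<close>. Hence the extension is Lipschitz, so a minimizer exists; it is at most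
  \<open>f S\<close> at the indicator vector of \<open>S\<close>; and it is at least \<open>x (\<sigma> k) * f (X\<^sub>k)\<close> for a decreasing \<open>\<sigma>\<close>.
  If \<open>X\<^sub>k\<close> is the first feasible prefix, then \<open>X\<^bsub>k-1\<^esub>\<close> violates the constraint of some \<open>W\<close>, and since
  \<open>x\<close> satisfies it with entries at most \<open>x (\<sigma> k)\<close> outside \<open>X\<^bsub>k-1\<^esub>\<close>, we get
  \<open>x (\<sigma> k) \<ge> 1 / (card W - b W + 1)\<close>. The same inequality bounds the integrality gap from above.
\<close>

section \<open>Marginal vectors along an ordering\<close>

text \<open>Indexed by elements rather than positions, hence the inverse of \<sigma>, so that it
  pairs with vectors such as \<open>x\<close>. For submodular \<open>f\<close> with
  \<open>f {} = 0\<close> this is the greedy vertex of the base polytope.\<close>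

definition marginal :: "('v::finite set \<Rightarrow> real) \<Rightarrow> (nat \<Rightarrow> 'v) \<Rightarrow> 'v \<Rightarrow> real" where
  "marginal f \<sigma> v =
     (let i = inv_into {1..CARD('v)} \<sigma> v in f (\<sigma> ` {1..i}) - f (\<sigma> ` {1..i - 1}))"

text \<open>Sort a list of all elements by negated coordinates. List indices start at 0 and
  orderings at 1, hence the shift by one.\<close>

lemma decreasing_ordering_exists: "\<exists>\<sigma>. decreasing_ordering (x :: real ^ 'v::finite) \<sigma>"
proof -
  obtain ys :: "'v list" where ys: "set ys = UNIV" "distinct ys"
    using finite_distinct_list[OF finite] by blast
  define xs where "xs = sort_key (\<lambda>v. - x $ v) ys"
  have xs: "set xs = UNIV" "distinct xs" "sorted (map (\<lambda>v. - x $ v) xs)"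
    using ys by (auto simp: xs_def)
  have len: "length xs = CARD('v)"
    using distinct_card[OF xs(2)] xs(1) by simp
  have "bij_betw (\<lambda>i. i - 1) {1..CARD('v)} {..<CARD('v)}"
    by (rule bij_betw_byWitness[where f' = Suc]) auto
  moreover have "bij_betw ((!) xs) {..<CARD('v)} UNIV"
    using bij_betw_nth[OF xs(2)] len xs(1) by metis
  ultimately have "bij_betw (\<lambda>i. xs ! (i - 1)) {1..CARD('v)} UNIV"
    using bij_betw_trans[of "\<lambda>i. i - 1" _ _ "(!) xs"] by (simp add: comp_def)
  moreover have "x $ (xs ! (j - 1)) \<le> x $ (xs ! (i - 1))"
    if "i \<in> {1..CARD('v)}" "j \<in> {1..CARD('v)}" "i \<le> j" for i j
  proof -
    have "i - 1 \<le> j - 1" "j - 1 < length xs" using that len by auto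
    then show ?thesis using sorted_nth_mono[OF xs(3), of "i - 1" "j - 1"] by simp
  qed
  ultimately show ?thesis unfolding decreasing_ordering_def by blast
qed

lemma decreasing_orderingD:
  fixes x :: "real ^ 'v::finite"
  assumes "decreasing_ordering x \<sigma>"
  shows "bij_betw \<sigma> {1..CARD('v)} UNIV"
    and "\<lbrakk>1 \<le> i; i \<le> j; j \<le> CARD('v)\<rbrakk> \<Longrightarrow> x $ \<sigma> j \<le> x $ \<sigma> i"
  using assms unfolding decreasing_ordering_def by auto

lemma marginal_nth:
  fixes \<sigma> :: "nat \<Rightarrow> 'v::finite"
  assumes "bij_betw \<sigma> {1..CARD('v)} UNIV" "1 \<le> i" "i \<le> CARD('v)"
  shows "marginal f \<sigma> (\<sigma> i) = f (\<sigma> ` {1..i}) - f (\<sigma> ` {1..i - 1})"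
proof -
  have "inv_into {1..CARD('v)} \<sigma> (\<sigma> i) = i"
    using assms by (intro inv_into_f_f) (auto simp: bij_betw_def)
  then show ?thesis by (simp add: marginal_def)
qed

lemma sum_marginal_prefix:
  fixes \<sigma> :: "nat \<Rightarrow> 'v::finite"
  assumes "bij_betw \<sigma> {1..CARD('v)} UNIV" "k \<le> CARD('v)" "f {} = 0"
  shows "(\<Sum>i = 1..k. marginal f \<sigma> (\<sigma> i)) = f (\<sigma> ` {1..k})"
  using assms(2)
proof (induction k)
  case (Suc k)
  then show ?case using marginal_nth[OF assms(1), of "Suc k" f] by simp
qed (simp add: assms(3))

lemma sum_prefix:
  fixes \<sigma> :: "nat \<Rightarrow> 'v::finite"
  assumes "bij_betw \<sigma> {1..CARD('v)} UNIV" "k \<le> CARD('v)"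
  shows "(\<Sum>v\<in>\<sigma> ` {1..k}. g v) = (\<Sum>i = 1..k. g (\<sigma> i))"
  by (rule sum.reindex_cong[of \<sigma>])
     (use assms in \<open>auto simp: bij_betw_def intro: inj_on_subset\<close>)

lemma sum_ordering:
  fixes \<sigma> :: "nat \<Rightarrow> 'v::finite"
  assumes "bij_betw \<sigma> {1..CARD('v)} UNIV"
  shows "(\<Sum>v\<in>UNIV. g v) = (\<Sum>i = 1..CARD('v). g (\<sigma> i))"
  using sum_prefix[OF assms order.refl, of g] assms by (simp add: bij_betw_def)

lemma marginal_nonneg:
  fixes \<sigma> :: "nat \<Rightarrow> 'v::finite"
  assumes "bij_betw \<sigma> {1..CARD('v)} UNIV" "mono f"
  shows "0 \<le> marginal f \<sigma> v"
proof -
  have "f (\<sigma> ` {1..i - 1}) \<le> f (\<sigma> ` {1..i})" for i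
    by (intro monoD[OF assms(2)] image_mono) auto
  then show ?thesis by (simp add: marginal_def Let_def)
qed

text \<open>Diminishing returns: the marginal of \<open>\<sigma> (Suc k)\<close> over the whole
  prefix is at most its marginal over the part of the prefix inside \<open>S\<close>. Summing the
  latter telescopes to \<open>f S\<close>.\<close>

lemma sum_marginal_le:
  fixes \<sigma> :: "nat \<Rightarrow> 'v::finite"
  assumes \<sigma>: "bij_betw \<sigma> {1..CARD('v)} UNIV" and f: "submodular f" "f {} = 0"
  shows "sum (marginal f \<sigma>) S \<le> f S"
proof -
  have "(\<Sum>i = 1..k. if \<sigma> i \<in> S then marginal f \<sigma> (\<sigma> i) else 0) \<le> f (S \<inter> \<sigma> ` {1..k})"
    if "k \<le> CARD('v)" for k
    using that
  proof (induction k)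
    case (Suc k)
    have img: "\<sigma> ` {1..Suc k} = insert (\<sigma> (Suc k)) (\<sigma> ` {1..k})"
      by (simp add: atLeastAtMostSuc_conv)
    show ?case
    proof (cases "\<sigma> (Suc k) \<in> S")
      case True
      have un: "(S \<inter> \<sigma> ` {1..Suc k}) \<union> \<sigma> ` {1..k} = \<sigma> ` {1..Suc k}"
        and int: "(S \<inter> \<sigma> ` {1..Suc k}) \<inter> \<sigma> ` {1..k} = S \<inter> \<sigma> ` {1..k}"
        using True unfolding img by auto
      have "f (\<sigma> ` {1..Suc k}) + f (S \<inter> \<sigma> ` {1..k}) \<le> f (S \<inter> \<sigma> ` {1..Suc k}) + f (\<sigma> ` {1..k})"
        using f(1) un int unfolding submodular_def by metis
      with Suc marginal_nth[OF \<sigma>, of "Suc k" f] True show ?thesis by simp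
    next
      case False
      then have "S \<inter> \<sigma> ` {1..Suc k} = S \<inter> \<sigma> ` {1..k}" unfolding img by auto
      with Suc False show ?thesis by simp
    qed
  qed (simp add: f(2))
  from this[of "CARD('v)"]
  have "(\<Sum>i = 1..CARD('v). if \<sigma> i \<in> S then marginal f \<sigma> (\<sigma> i) else 0) \<le> f S"
    using \<sigma> by (simp add: bij_betw_def)
  moreover have "sum (marginal f \<sigma>) S = (\<Sum>v\<in>UNIV. if v \<in> S then marginal f \<sigma> v else 0)"
    by (simp add: sum.If_cases)
  ultimately show ?thesis by (simp add: sum_ordering[OF \<sigma>])
qed

lemma sum_marginal_UNIV:
  fixes \<sigma> :: "nat \<Rightarrow> 'v::finite"
  assumes "bij_betw \<sigma> {1..CARD('v)} UNIV" "f {} = 0"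
  shows "sum (marginal f \<sigma>) UNIV = f UNIV"
  using sum_ordering[OF assms(1), of "marginal f \<sigma>"] sum_marginal_prefix[OF assms(1) order.refl, of f]
    assms by (simp add: bij_betw_def)

section \<open>The Lovasz extension as a maximum over orderings\<close>

text \<open>Induction on \<open>k\<close>: lowering the common weight from \<open>y k\<close> to
  \<open>y (Suc k)\<close> cannot increase its product with a nonnegative partial sum. The single
  \<open>d i\<close> may have any sign.\<close>

lemma Abel_sum_ge:
  fixes y d :: "nat \<Rightarrow> real"
  assumes "\<And>i j. \<lbrakk>1 \<le> i; i \<le> j; j \<le> n\<rbrakk> \<Longrightarrow> y j \<le> y i"
    and "\<And>k. k \<le> n \<Longrightarrow> 0 \<le> (\<Sum>i = 1..k. d i)"
    and "k \<le> n"
  shows "y k * (\<Sum>i = 1..k. d i) \<le> (\<Sum>i = 1..k. y i * d i)"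
  using assms(3)
proof (induction k)
  case (Suc k)
  have "y (Suc k) * (\<Sum>i = 1..k. d i) \<le> y k * (\<Sum>i = 1..k. d i)"
  \<comment> \<open>Nothing relates \<open>y 0\<close> to \<open>y 1\<close>, but for
    \<open>k = 0\<close> the partial sum is empty.\<close>
  proof (cases "k = 0")
    case False
    then show ?thesis using Suc.prems assms(1)[of k "Suc k"] assms(2)[of k]
      by (intro mult_right_mono) auto
  qed simp
  with Suc show ?case by (simp add: algebra_simps)
qed simp

text \<open>Edmonds' greedy argument.\<close>
lemma sum_marginal_le_decreasing:
  fixes x :: "real ^ 'v::finite"
  assumes f: "submodular f" "f {} = 0"
    and \<sigma>: "decreasing_ordering x \<sigma>" and \<tau>: "bij_betw \<tau> {1..CARD('v)} UNIV"
  shows "(\<Sum>v\<in>UNIV. x $ v * marginal f \<tau> v) \<le> (\<Sum>v\<in>UNIV. x $ v * marginal f \<sigma> v)"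
proof -
  note bij = decreasing_orderingD(1)[OF \<sigma>]
  let ?n = "CARD('v)"
  define d where "d i = marginal f \<sigma> (\<sigma> i) - marginal f \<tau> (\<sigma> i)" for i
  have D: "(\<Sum>i = 1..k. d i) = f (\<sigma> ` {1..k}) - sum (marginal f \<tau>) (\<sigma> ` {1..k})"
    if "k \<le> ?n" for k
    unfolding d_def sum_subtractf sum_prefix[OF bij that]
      sum_marginal_prefix[where f = f, OF bij that f(2)] by (rule refl)
  have "\<sigma> ` {1..?n} = UNIV" using bij by (simp add: bij_betw_def)
  \<comment> \<open>Both marginal vectors have total \<open>f UNIV\<close>, so the left side of the
    Abel bound vanishes, whatever the sign of the smallest coordinate of \<open>x\<close>.\<close>
  then have 0: "(\<Sum>i = 1..?n. d i) = 0"
    using D[of ?n] sum_marginal_UNIV[of \<tau> f] \<tau> f(2) by simp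
  have "x $ \<sigma> ?n * (\<Sum>i = 1..?n. d i) \<le> (\<Sum>i = 1..?n. x $ \<sigma> i * d i)"
    by (rule Abel_sum_ge[of ?n "\<lambda>i. x $ \<sigma> i" d])
       (use decreasing_orderingD(2)[OF \<sigma>] D sum_marginal_le[OF \<tau> f] in auto)
  then show ?thesis
    unfolding 0 sum_ordering[OF bij] by (simp add: d_def sum_subtractf algebra_simps)
qed

text \<open>Confines the choice operator to one place; afterwards the extension is handled only as
  an inner product with a marginal vector.\<close>

lemma lovasz_extension_some:
  fixes x :: "real ^ 'v::finite"
  obtains \<sigma> where "decreasing_ordering x \<sigma>"
    and "\<And>f. lovasz_extension f x = (\<Sum>v\<in>UNIV. x $ v * marginal f \<sigma> v)"
proof -
  define \<sigma> where "\<sigma> = (SOME \<sigma>. decreasing_ordering x \<sigma>)"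
  have \<sigma>: "decreasing_ordering x \<sigma>"
    unfolding \<sigma>_def using decreasing_ordering_exists by (rule someI_ex)
  note bij = decreasing_orderingD(1)[OF this]
  have "lovasz_extension f x = (\<Sum>v\<in>UNIV. x $ v * marginal f \<sigma> v)" for f
    unfolding lovasz_extension_def Let_def \<sigma>_def[symmetric] sum_ordering[OF bij]
    by (intro sum.cong) (auto simp: marginal_nth[OF bij])
  with \<sigma> show ?thesis by (rule that)
qed

text \<open>Two decreasing orderings of the same \<open>x\<close> bound each other by the greedy
  argument, so tie-breaking does not affect the value.\<close>

lemma lovasz_extension_decreasing:
  fixes x :: "real ^ 'v::finite"
  assumes "submodular f" "f {} = 0" "decreasing_ordering x \<sigma>"
  shows "lovasz_extension f x = (\<Sum>v\<in>UNIV. x $ v * marginal f \<sigma> v)"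
proof -
  obtain \<tau> where \<tau>: "decreasing_ordering x \<tau>"
    and "lovasz_extension f x = (\<Sum>v\<in>UNIV. x $ v * marginal f \<tau> v)"
    by (rule lovasz_extension_some) blast
  moreover have "(\<Sum>v\<in>UNIV. x $ v * marginal f \<tau> v) = (\<Sum>v\<in>UNIV. x $ v * marginal f \<sigma> v)"
    using sum_marginal_le_decreasing[OF assms decreasing_orderingD(1)[OF \<tau>]]
      sum_marginal_le_decreasing[OF assms(1,2) \<tau> decreasing_orderingD(1)[OF assms(3)]]
    by (rule antisym)
  ultimately show ?thesis by simp
qed

lemma lovasz_extension_ge:
  fixes x :: "real ^ 'v::finite"
  assumes "submodular f" "f {} = 0" "bij_betw \<tau> {1..CARD('v)} UNIV"
  shows "(\<Sum>v\<in>UNIV. x $ v * marginal f \<tau> v) \<le> lovasz_extension f x"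
  by (metis assms decreasing_ordering_exists lovasz_extension_decreasing sum_marginal_le_decreasing)

section \<open>Continuity and bounds of the Lovasz extension\<close>

lemma normalized_mono_submodularD:
  assumes "normalized_mono_submodular f"
  shows "0 \<le> f S" "mono f" "submodular f" "f {} = 0"
  using assms unfolding normalized_mono_submodular_def by auto

text \<open>Evaluate both points along a decreasing ordering of \<open>x\<close>: this is exact at
  \<open>x\<close> and a lower bound at \<open>y\<close>. What remains is a linear functional of
  \<open>x - y\<close> whose nonnegative coefficients sum to \<open>f UNIV\<close>.\<close>

lemma lovasz_extension_diff_le:
  fixes x y :: "real ^ 'v::finite"
  assumes f: "normalized_mono_submodular f"
  shows "lovasz_extension f x - lovasz_extension f y \<le> f UNIV * norm (x - y)"
proof -
  note f = normalized_mono_submodularD[OF f]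
  obtain \<sigma> where \<sigma>: "decreasing_ordering x \<sigma>" using decreasing_ordering_exists by blast
  note bij = decreasing_orderingD(1)[OF this]
  have "lovasz_extension f x - lovasz_extension f y
      \<le> (\<Sum>v\<in>UNIV. x $ v * marginal f \<sigma> v) - (\<Sum>v\<in>UNIV. y $ v * marginal f \<sigma> v)"
    using lovasz_extension_ge[OF f(3,4) bij, of y] lovasz_extension_decreasing[OF f(3,4) \<sigma>] by simp
  also have "\<dots> = (\<Sum>v\<in>UNIV. (x - y) $ v * marginal f \<sigma> v)"
    by (simp add: sum_subtractf algebra_simps)
  also have "\<dots> \<le> (\<Sum>v\<in>UNIV. norm (x - y) * marginal f \<sigma> v)"
    by (intro sum_mono mult_right_mono marginal_nonneg[OF bij f(2)]
          order.trans[OF abs_ge_self component_le_norm_cart])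
  also have "\<dots> = f UNIV * norm (x - y)"
    using sum_marginal_UNIV[of \<sigma> f, OF bij f(4)] by (simp add: sum_distrib_left[symmetric])
  finally show ?thesis .
qed

lemma continuous_on_lovasz_extension:
  assumes f: "normalized_mono_submodular f"
  shows "continuous_on A (lovasz_extension f)"
proof -
  have "(f UNIV)-lipschitz_on A (lovasz_extension f)"
  proof (rule lipschitz_onI)
    fix x y :: "real ^ 'a"
    show "dist (lovasz_extension f x) (lovasz_extension f y) \<le> f UNIV * dist x y"
      using lovasz_extension_diff_le[OF f, of x y] lovasz_extension_diff_le[OF f, of y x]
      by (simp add: dist_norm norm_minus_commute abs_le_iff)
  qed (use normalized_mono_submodularD(1)[OF f] in simp)
  then show ?thesis by (rule lipschitz_on_continuous_on)
qed

text \<open>The inner product with \<open>indicator_vec S\<close> collects the marginals over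
  \<open>S\<close>, and these sum to at most \<open>f S\<close>. This is what makes the relaxation a
  lower bound for the discrete problem.\<close>

lemma lovasz_extension_indicator_le:
  assumes f: "normalized_mono_submodular f"
  shows "lovasz_extension f (indicator_vec S) \<le> f S"
proof -
  note f = normalized_mono_submodularD[OF f]
  obtain \<sigma> where \<sigma>: "decreasing_ordering (indicator_vec S) \<sigma>"
    using decreasing_ordering_exists by blast
  have "lovasz_extension f (indicator_vec S) = sum (marginal f \<sigma>) S"
    unfolding lovasz_extension_decreasing[OF f(3,4) \<sigma>]
    by (simp add: indicator_vec_def indicator_def if_distrib[of "\<lambda>t. t * _"] sum.If_cases)
  also have "\<dots> \<le> f S"
    by (intro sum_marginal_le decreasing_orderingD(1)[OF \<sigma>] f)
  finally show ?thesis .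
qed

text \<open>All terms are nonnegative: drop those after position \<open>k\<close>, lower the earlier
  weights to \<open>x $ \<sigma> k\<close>, and telescope the marginals.\<close>

lemma lovasz_extension_prefix_ge:
  fixes x :: "real ^ 'v::finite"
  assumes f: "normalized_mono_submodular f" and x: "\<And>i. 0 \<le> x $ i"
    and \<sigma>: "decreasing_ordering x \<sigma>" and k: "1 \<le> k" "k \<le> CARD('v)"
  shows "x $ \<sigma> k * f (\<sigma> ` {1..k}) \<le> lovasz_extension f x"
proof -
  note f = normalized_mono_submodularD[OF f]
  note bij = decreasing_orderingD(1)[OF \<sigma>]
  have "x $ \<sigma> k * f (\<sigma> ` {1..k}) = (\<Sum>i = 1..k. x $ \<sigma> k * marginal f \<sigma> (\<sigma> i))"
    unfolding sum_distrib_left[symmetric] sum_marginal_prefix[where f = f, OF bij k(2) f(4)]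
    by (rule refl)
  also have "\<dots> \<le> (\<Sum>i = 1..k. x $ \<sigma> i * marginal f \<sigma> (\<sigma> i))"
    using decreasing_orderingD(2)[OF \<sigma>] k
    by (intro sum_mono mult_right_mono marginal_nonneg[OF bij f(2)]) auto
  also have "\<dots> \<le> (\<Sum>i = 1..CARD('v). x $ \<sigma> i * marginal f \<sigma> (\<sigma> i))"
    using x k by (intro sum_mono2 mult_nonneg_nonneg marginal_nonneg[OF bij f(2)]) auto
  also have "\<dots> = lovasz_extension f x"
    by (simp add: lovasz_extension_decreasing[OF f(3,4) \<sigma>] sum_ordering[OF bij])
  finally show ?thesis .
qed

section \<open>Compactness, costs and indicator vectors\<close>

lemma continuous_on_Max:
  fixes g :: "'i \<Rightarrow> 'a::topological_space \<Rightarrow> 'b::linorder_topology"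
  assumes "finite I" "I \<noteq> {}" "\<And>i. i \<in> I \<Longrightarrow> continuous_on A (g i)"
  shows "continuous_on A (\<lambda>x. MAX i\<in>I. g i x)"
  using assms
proof (induction rule: finite_ne_induct)
  case (insert i I)
  have "(\<lambda>x. MAX j\<in>insert i I. g j x) = (\<lambda>x. max (g i x) (MAX j\<in>I. g j x))"
    using insert.hyps by (auto simp: Max_insert)
  then show ?case using insert by (auto intro!: continuous_on_max)
qed simp

lemma compact_covering_polytope: "compact (covering_polytope \<W> b :: (real ^ 'v::finite) set)"
proof -
  have "covering_polytope \<W> b =
      (cbox 0 1 :: (real ^ 'v) set) \<inter> (\<Inter>W\<in>\<W>. {x. real_of_int (b W) \<le> (\<Sum>i\<in>W. x $ i)})"
    by (auto simp: covering_polytope_def mem_box_cart)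
  moreover have "closed (\<Inter>W\<in>\<W>. {x :: real ^ 'v. real_of_int (b W) \<le> (\<Sum>i\<in>W. x $ i)})"
    by (intro closed_INT ballI closed_Collect_le continuous_intros)
  ultimately show ?thesis by (simp add: compact_Int_closed)
qed

lemma robust_cost_upper: "i \<in> {1..l} \<Longrightarrow> f i X \<le> robust_cost l f X"
  unfolding robust_cost_def by (intro Max_ge) auto

lemma relaxed_cost_upper: "i \<in> {1..l} \<Longrightarrow> lovasz_extension (f i) x \<le> relaxed_cost l f x"
  unfolding relaxed_cost_def by (intro Max_ge) auto

lemma robust_cost_le_iff:
  "1 \<le> l \<Longrightarrow> robust_cost l f X \<le> c \<longleftrightarrow> (\<forall>i\<in>{1..l}. f i X \<le> c)"
  unfolding robust_cost_def by (subst Max_le_iff) auto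

lemma relaxed_cost_le_iff:
  "1 \<le> l \<Longrightarrow> relaxed_cost l f x \<le> c \<longleftrightarrow> (\<forall>i\<in>{1..l}. lovasz_extension (f i) x \<le> c)"
  unfolding relaxed_cost_def by (subst Max_le_iff) auto

lemma sum_indicator_vec: "(\<Sum>i\<in>W. indicator_vec S $ i) = real (card (S \<inter> W))"
  by (simp add: indicator_vec_def indicator_def sum.If_cases Int_commute)

lemma indicator_vec_inject: "indicator_vec S = indicator_vec T \<longleftrightarrow> S = T"
  by (auto simp: indicator_vec_def vec_eq_iff indicator_def split: if_splits)

lemma indicator_vec_in_covering_polytope:
  "indicator_vec S \<in> covering_polytope \<W> b \<longleftrightarrow> (\<forall>W\<in>\<W>. b W \<le> int (card (S \<inter> W)))"
  unfolding covering_polytope_def mem_Collect_eq sum_indicator_vec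
  by (auto simp: indicator_vec_def indicator_def of_int_le_iff[of _ "int _", where ?'a=real, simplified])

text \<open>Indicator vectors are 0/1 and determine their sets, so the equality of sets of vectors
  becomes a feasibility test for a single set.\<close>

lemma expressed_throughD:
  assumes "expressed_through C P"
  shows "S \<in> up_closure C \<longleftrightarrow> indicator_vec S \<in> P"
proof -
  have "\<forall>i. indicator_vec S $ i = 0 \<or> indicator_vec S $ i = 1"
    by (simp add: indicator_vec_def indicator_def)
  then have "indicator_vec S \<in> P \<longleftrightarrow> indicator_vec S \<in> indicator_vec ` up_closure C"
    using assms unfolding expressed_through_def by auto
  then show ?thesis by (auto simp: indicator_vec_inject)
qed

lemma approx_factor_ge:
  fixes \<W> :: "'v::finite set set"
  assumes "W \<in> \<W>"
  shows "int (card W) - b W + 1 \<le> approx_factor \<W> b"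
  unfolding approx_factor_def using assms by (intro Max_ge) auto

lemma approx_factor_pos:
  fixes \<W> :: "'v::finite set set"
  assumes "\<W> \<noteq> {}" "\<forall>W\<in>\<W>. b W \<le> int (card W)"
  shows "1 \<le> approx_factor \<W> b"
  using assms approx_factor_ge[of _ \<W> b] by force

section \<open>Rounding to the first feasible prefix\<close>

text \<open>Let \<open>m\<close> count the elements of a violated \<open>W\<close> in the prefix of
  length \<open>k - 1\<close>. They contribute at most 1 each to the constraint at \<open>x\<close>,
  the others at most \<open>x $ \<sigma> k\<close>. The worst case is
  \<open>m = b W - 1\<close>.\<close>

lemma threshold_ge:
  fixes x :: "real ^ 'v::finite"
  assumes b: "\<forall>W\<in>\<W>. b W \<le> int (card W)"
    and x: "x \<in> covering_polytope \<W> b" and \<sigma>: "decreasing_ordering x \<sigma>"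
    and k: "1 \<le> k" "k \<le> CARD('v)"
    and inf: "indicator_vec (\<sigma> ` {1..k - 1}) \<notin> covering_polytope \<W> b"
  shows "1 \<le> real_of_int (approx_factor \<W> b) * x $ \<sigma> k"
proof -
  let ?X = "\<sigma> ` {1..k - 1}"
  let ?t = "x $ \<sigma> k"
  have x01: "0 \<le> x $ i" "x $ i \<le> 1" for i using x by (auto simp: covering_polytope_def)
  obtain W where W: "W \<in> \<W>" "int (card (?X \<inter> W)) < b W"
    using inf by (auto simp: indicator_vec_in_covering_polytope not_le)
  have "x $ v \<le> ?t" if "v \<notin> ?X" for v
  proof -
    obtain i where i: "i \<in> {1..CARD('v)}" "v = \<sigma> i"
      using decreasing_orderingD(1)[OF \<sigma>] by (metis UNIV_I bij_betw_def imageE)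
    with that have "\<not> i \<le> k - 1" by auto
    with i k show ?thesis using decreasing_orderingD(2)[OF \<sigma>, of k i] by auto
  qed
  then have "(\<Sum>v\<in>W - ?X. x $ v) \<le> real (card (W - ?X)) * ?t"
    by (intro sum_bounded_above) auto
  moreover have "(\<Sum>v\<in>?X \<inter> W. x $ v) \<le> real (card (?X \<inter> W))"
    using sum_bounded_above[of "?X \<inter> W" "\<lambda>v. x $ v" 1] x01 by simp
  moreover have "real_of_int (b W) \<le> (\<Sum>v\<in>W. x $ v)"
    using x W(1) by (auto simp: covering_polytope_def)
  moreover have "(\<Sum>v\<in>W. x $ v) = (\<Sum>v\<in>W - ?X. x $ v) + (\<Sum>v\<in>?X \<inter> W. x $ v)"
    by (subst sum.Int_Diff[of W _ ?X]) (auto simp: Int_commute)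
  moreover have "card (W - ?X) + card (?X \<inter> W) = card W"
    by (metis Int_commute add.commute card_Int_Diff finite)
  then have "real (card (W - ?X)) = real (card W) - real (card (?X \<inter> W))" by linarith
  moreover define m where "m = int (card (?X \<inter> W))"
  ultimately have "real_of_int (b W) \<le> (real (card W) - m) * ?t + m"
    by (simp only: of_int_of_nat_eq)
  \<comment> \<open>Integrality turns \<open>m < b W\<close> into \<open>m \<le> b W - 1\<close>.
    Adding this product to the preceding inequality replaces \<open>m\<close> by
    \<open>b W - 1\<close>.\<close>
  moreover have "0 \<le> (real_of_int (b W) - 1 - m) * (1 - ?t)"
    using W(2) x01 by (intro mult_nonneg_nonneg) (auto simp: m_def)
  ultimately have "1 \<le> (real (card W) - b W + 1) * ?t" by (simp add: algebra_simps)
  also have "\<dots> \<le> real_of_int (approx_factor \<W> b) * ?t"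
    using approx_factor_ge[OF W(1), of b] x01
    by (intro mult_right_mono) linarith+
  finally show ?thesis .
qed

text \<open>For each cost separately, multiply the threshold bound by \<open>f i\<close> of the
  prefix and apply the prefix lower bound for its extension.\<close>

lemma rounded_prefix_le:
  fixes x :: "real ^ 'v::finite"
  assumes l: "1 \<le> l" and f: "\<forall>i\<in>{1..l}. normalized_mono_submodular (f i)"
    and b: "\<W> \<noteq> {}" "\<forall>W\<in>\<W>. b W \<le> int (card W)"
    and x: "x \<in> covering_polytope \<W> b" and \<sigma>: "decreasing_ordering x \<sigma>"
    and k: "k \<le> CARD('v)"
    and inf: "\<forall>j<k. indicator_vec (\<sigma> ` {1..j}) \<notin> covering_polytope \<W> b"
  shows "robust_cost l f (\<sigma> ` {1..k}) \<le> real_of_int (approx_factor \<W> b) * relaxed_cost l f x"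
  unfolding robust_cost_le_iff[OF l]
proof
  fix i assume i: "i \<in> {1..l}"
  then have fi: "normalized_mono_submodular (f i)" using f by blast
  note fD = normalized_mono_submodularD[OF fi]
  let ?\<alpha> = "real_of_int (approx_factor \<W> b)"
  have \<alpha>: "0 \<le> ?\<alpha>" using approx_factor_pos[OF b] by simp
  have x01: "0 \<le> x $ i" for i using x by (auto simp: covering_polytope_def)
  have "f i (\<sigma> ` {1..k}) \<le> ?\<alpha> * lovasz_extension (f i) x"
  \<comment> \<open>The empty prefix has no last element to serve as threshold; it costs 0, and the
    extension is nonnegative at \<open>x\<close>.\<close>
  proof (cases "k = 0")
    case True
    have "0 \<le> lovasz_extension (f i) x"
      unfolding lovasz_extension_decreasing[OF fD(3,4) \<sigma>]
      by (intro sum_nonneg mult_nonneg_nonneg x01 marginal_nonneg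
          decreasing_orderingD(1)[OF \<sigma>] fD)
    with True \<alpha> show ?thesis by (simp add: fD)
  next
    case False
    then have "1 * f i (\<sigma> ` {1..k}) \<le> (?\<alpha> * x $ \<sigma> k) * f i (\<sigma> ` {1..k})"
      using k inf by (intro mult_right_mono threshold_ge[OF b(2) x \<sigma>] fD) auto
    also have "\<dots> = ?\<alpha> * (x $ \<sigma> k * f i (\<sigma> ` {1..k}))" by simp
    also have "\<dots> \<le> ?\<alpha> * lovasz_extension (f i) x"
      using False k by (intro mult_left_mono lovasz_extension_prefix_ge fi x01 \<sigma> \<alpha>) auto
    finally show ?thesis by simp
  qed
  also have "\<dots> \<le> ?\<alpha> * relaxed_cost l f x"
    by (intro mult_left_mono relaxed_cost_upper i \<alpha>)
  finally show "f i (\<sigma> ` {1..k}) \<le> ?\<alpha> * relaxed_cost l f x" .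
qed

section \<open>Minimizers and runs of the scheme\<close>

text \<open>A maximum of finitely many continuous functions attains its infimum on a compact set.
  Thus the scheme can start, and \<open>relaxed_opt\<close> is a genuine minimum.\<close>

lemma relaxed_minimizer_exists:
  assumes l: "1 \<le> l" and f: "\<forall>i\<in>{1..l}. normalized_mono_submodular (f i)"
    and P: "compact P" "P \<noteq> {}"
  obtains x where "is_arg_min (relaxed_cost l f) (\<lambda>x. x \<in> P) x"
proof -
  have "continuous_on P (relaxed_cost l f)"
    unfolding relaxed_cost_def[abs_def] using l f
    by (intro continuous_on_Max continuous_on_lovasz_extension) auto
  from continuous_attains_inf[OF P this] show ?thesis
    using that by (auto simp: is_arg_min_linorder)
qed

lemma relaxed_opt_arg_min:
  assumes "is_arg_min (relaxed_cost l f) (\<lambda>x. x \<in> P) x"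
  shows "relaxed_opt l f P = relaxed_cost l f x"
  unfolding relaxed_opt_def using assms
  by (intro cInf_eq_minimum) (auto simp: is_arg_min_linorder)

text \<open>The full prefix is the ground set, which is feasible because \<open>C\<close> is
  nonempty; hence a least feasible prefix exists.\<close>

lemma relaxation_scheme_run:
  fixes x :: "real ^ 'v::finite"
  assumes C: "C \<noteq> {}" and \<sigma>: "decreasing_ordering x \<sigma>"
  obtains k X where "k \<le> CARD('v)" "\<sigma> ` {1..k} \<in> up_closure C"
    "\<forall>j<k. \<sigma> ` {1..j} \<notin> up_closure C" "X \<in> C" "X \<subseteq> \<sigma> ` {1..k}"
proof -
  have "\<sigma> ` {1..CARD('v)} \<in> up_closure C"
    using C decreasing_orderingD(1)[OF \<sigma>] by (auto simp: up_closure_def bij_betw_def)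
  then have *: "\<exists>k. \<sigma> ` {1..k} \<in> up_closure C" by blast
  let ?k = "LEAST k. \<sigma> ` {1..k} \<in> up_closure C"
  have k: "\<sigma> ` {1..?k} \<in> up_closure C" using * by (rule LeastI_ex)
  then obtain X where "X \<in> C" "X \<subseteq> \<sigma> ` {1..?k}" by (auto simp: up_closure_def)
  moreover have "?k \<le> CARD('v)" by (rule Least_le) fact
  moreover have "\<forall>j<?k. \<sigma> ` {1..j} \<notin> up_closure C" using not_less_Least by blast
  ultimately show ?thesis using k that by blast
qed

lemma relaxation_scheme_output_exists:
  assumes "1 \<le> l" "\<forall>i\<in>{1..l}. normalized_mono_submodular (f i)"
    and "C \<noteq> {}" "compact P" "P \<noteq> {}"
  shows "\<exists>X. relaxation_scheme_output l f C P X"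
proof -
  obtain x where x: "is_arg_min (relaxed_cost l f) (\<lambda>x. x \<in> P) x"
    using relaxed_minimizer_exists[OF assms(1,2,4,5)] by blast
  obtain \<sigma> where \<sigma>: "decreasing_ordering x \<sigma>" using decreasing_ordering_exists by blast
  show ?thesis
    by (rule relaxation_scheme_run[OF assms(3) \<sigma>]) (use x \<sigma> in \<open>auto simp: relaxation_scheme_output_def\<close>)
qed

text \<open>By monotonicity the output costs no more than the prefix containing it. Comparing with
  the relaxed optimum gives both the approximation guarantee and the upper bound on the integrality
  gap.\<close>

lemma relaxation_scheme_output_le_relaxed_opt:
  fixes C \<W> :: "'v::finite set set"
  assumes l: "1 \<le> l" and f: "\<forall>i\<in>{1..l}. normalized_mono_submodular (f i)"
    and b: "\<W> \<noteq> {}" "\<forall>W\<in>\<W>. b W \<le> int (card W)"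
    and C: "expressed_through C (covering_polytope \<W> b)"
    and X: "relaxation_scheme_output l f C (covering_polytope \<W> b) X"
  shows "robust_cost l f X \<le> real_of_int (approx_factor \<W> b) * relaxed_opt l f (covering_polytope \<W> b)"
proof -
  from X obtain x \<sigma> k where
    x: "is_arg_min (relaxed_cost l f) (\<lambda>x. x \<in> covering_polytope \<W> b) x" and
    \<sigma>: "decreasing_ordering x \<sigma>" and k: "k \<le> CARD('v)" and
    inf: "\<forall>j<k. \<sigma> ` {1..j} \<notin> up_closure C" and sub: "X \<subseteq> \<sigma> ` {1..k}"
    unfolding relaxation_scheme_output_def by blast
  have "robust_cost l f X \<le> robust_cost l f (\<sigma> ` {1..k})"
    unfolding robust_cost_le_iff[OF l]
  proof
    fix i assume i: "i \<in> {1..l}"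
    then have "f i X \<le> f i (\<sigma> ` {1..k})"
      using f sub by (intro monoD[OF normalized_mono_submodularD(2)]) auto
    then show "f i X \<le> robust_cost l f (\<sigma> ` {1..k})" using robust_cost_upper[OF i] order.trans by blast
  qed
  also have "\<dots> \<le> real_of_int (approx_factor \<W> b) * relaxed_cost l f x"
    using x inf by (intro rounded_prefix_le l f b \<sigma> k)
      (auto simp: is_arg_min_def expressed_throughD[OF C])
  finally show ?thesis by (simp add: relaxed_opt_arg_min[OF x])
qed

section \<open>Comparison of the discrete and relaxed optima\<close>

lemma robust_opt_le:
  fixes C :: "'v::finite set set"
  assumes "X \<in> C"
  shows "robust_opt l f C \<le> robust_cost l f X"
  unfolding robust_opt_def using assms by (intro Min_le) auto

text \<open>The indicator vector of an optimal set lies in \<open>P\<close>, and its relaxed cost is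
  at most the cost of the set.\<close>

lemma relaxed_opt_le_robust_opt:
  fixes C :: "'v::finite set set"
  assumes l: "1 \<le> l" and f: "\<forall>i\<in>{1..l}. normalized_mono_submodular (f i)"
    and C: "C \<noteq> {}" "compact P" "\<And>X. X \<in> C \<Longrightarrow> indicator_vec X \<in> P"
  shows "relaxed_opt l f P \<le> robust_opt l f C"
proof -
  have "robust_opt l f C \<in> robust_cost l f ` C"
    unfolding robust_opt_def using C(1) by (intro Min_in) auto
  then obtain X where X: "X \<in> C" "robust_opt l f C = robust_cost l f X" by blast
  obtain x where x: "is_arg_min (relaxed_cost l f) (\<lambda>x. x \<in> P) x"
    using relaxed_minimizer_exists[OF l f C(2)] C(3) X(1) by blast
  have "relaxed_opt l f P \<le> relaxed_cost l f (indicator_vec X)"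
    unfolding relaxed_opt_arg_min[OF x] using x C(3)[OF X(1)] by (simp add: is_arg_min_linorder)
  also have "\<dots> \<le> robust_cost l f X"
    unfolding relaxed_cost_le_iff[OF l]
    using f lovasz_extension_indicator_le robust_cost_upper order.trans by blast
  finally show ?thesis using X by simp
qed

section \<open>Extremal instances for disjoint constraints\<close>

text \<open>This is the rank function of the matroid whose loops are the elements outside
  \<open>U\<close> and in which the elements of \<open>U\<close> are parallel.\<close>

lemma normalized_mono_submodular_hitting:
  "normalized_mono_submodular (\<lambda>S. if S \<inter> U = {} then 0 else 1)"
  by (auto simp: normalized_mono_submodular_def submodular_def mono_def)

text \<open>The marginals vanish outside \<open>U\<close> and sum to 1, so the value is a weighted
  average of the coordinates in \<open>U\<close>.\<close>

lemma lovasz_extension_hitting_le: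
  fixes x :: "real ^ 'v::finite"
  assumes "U \<noteq> {}" and x: "\<And>v. v \<in> U \<Longrightarrow> x $ v \<le> c"
  shows "lovasz_extension (\<lambda>S. if S \<inter> U = {} then 0 else 1) x \<le> c"
proof -
  let ?f = "\<lambda>S. if S \<inter> U = {} then 0 else (1::real)"
  note f = normalized_mono_submodularD[OF normalized_mono_submodular_hitting[of U]]
  obtain \<sigma> where \<sigma>: "decreasing_ordering x \<sigma>" using decreasing_ordering_exists by blast
  note bij = decreasing_orderingD(1)[OF \<sigma>]
  have 0: "marginal ?f \<sigma> v = 0" if "v \<notin> U" for v
    using marginal_nonneg[OF bij f(2), of v] sum_marginal_le[OF bij f(3,4), of "{v}"] that by simp
  have "lovasz_extension ?f x = (\<Sum>v\<in>UNIV. x $ v * marginal ?f \<sigma> v)"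
    by (rule lovasz_extension_decreasing[OF f(3,4) \<sigma>])
  also have "\<dots> \<le> (\<Sum>v\<in>UNIV. c * marginal ?f \<sigma> v)"
  proof (rule sum_mono)
    fix v
    show "x $ v * marginal ?f \<sigma> v \<le> c * marginal ?f \<sigma> v"
      using x[of v] 0[of v] marginal_nonneg[OF bij f(2), of v]
      by (cases "v \<in> U") (auto intro: mult_right_mono)
  qed
  also have "\<dots> = c"
    using sum_marginal_UNIV[of \<sigma> ?f, OF bij f(4)] assms(1) by (simp add: sum_distrib_left[symmetric])
  finally show ?thesis .
qed

text \<open>
  The extremal cost is the indicator of hitting \<open>W - T\<close>, where \<open>card T = b W - 1\<close>: every feasible
  set hits \<open>W - T\<close>, while fractionally weight \<open>1 / card (W - T)\<close> on \<open>W - T\<close> is enough.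
\<close>
lemma integrality_gap_instance:
  fixes C \<W> :: "'v::finite set set"
  assumes l: "1 \<le> l" and C: "C \<noteq> {}" "expressed_through C (covering_polytope \<W> b)"
    and b: "\<forall>W\<in>\<W>. 1 \<le> b W \<and> b W \<le> int (card W)"
    and disj: "pairwise disjnt \<W>" and W: "W \<in> \<W>"
  obtains f where "normalized_mono_submodular f"
    and "1 \<le> robust_opt l (\<lambda>_. f) C"
    and "relaxed_opt l (\<lambda>_. f) (covering_polytope \<W> b) \<le> 1 / real_of_int (int (card W) - b W + 1)"
proof -
  let ?P = "covering_polytope \<W> b"
  have "nat (b W - 1) \<le> card W" using b W by force
  then obtain T where T: "T \<subseteq> W" "card T = nat (b W - 1)"
    by (metis obtain_subset_with_card_n)
  then have cT: "int (card T) = b W - 1" using b W by force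
  define U where "U = W - T"
  have cU: "int (card U) = int (card W) - b W + 1"
    using cT T(1) by (simp add: U_def card_Diff_subset card_mono of_nat_diff)
  have U0: "U \<noteq> {}" using cU b W by force
  define c where "c = 1 / real (card U)"
  have U1: "1 \<le> card U" using U0 by (simp add: Suc_le_eq card_gt_0_iff)
  have c: "0 \<le> c" "c \<le> 1" using U1 by (auto simp: c_def)
  let ?f = "\<lambda>S. if S \<inter> U = {} then 0 else (1::real)"
  have f: "normalized_mono_submodular ?f" by (rule normalized_mono_submodular_hitting)
  have "1 \<le> robust_cost l (\<lambda>_. ?f) X" if "X \<in> C" for X
  proof -
    have "indicator_vec X \<in> ?P"
      using that expressed_throughD[OF C(2)] by (auto simp: up_closure_def)
    \<comment> \<open>A feasible set takes at least \<open>b W = card T + 1\<close> elements of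
      \<open>W\<close>, so they cannot all lie in \<open>T\<close>.\<close>
    then have "card T < card (X \<inter> W)"
      using W cT by (auto simp: indicator_vec_in_covering_polytope)
    then have "\<not> X \<inter> W \<subseteq> T" by (meson card_mono finite not_le)
    then have "?f X = 1" by (auto simp: U_def)
    with robust_cost_upper[of 1 l "\<lambda>_. ?f" X] l show ?thesis by simp
  qed
  then have rob: "1 \<le> robust_opt l (\<lambda>_. ?f) C"
    unfolding robust_opt_def using C(1) by (subst Min_ge_iff) auto
  \<comment> \<open>On \<open>W\<close>, the part \<open>T\<close> contributes
    \<open>b W - 1\<close> and \<open>U\<close> contributes 1, so this constraint is tight. Any
    other member of \<W> is disjoint from \<open>W\<close>, hence avoids \<open>U\<close> and has
    all its coordinates equal to 1.\<close>
  define x :: "real ^ 'v" where "x = (\<chi> v. if v \<in> U then c else 1)"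
  have "x \<in> ?P"
    unfolding covering_polytope_def mem_Collect_eq
  proof (intro conjI allI ballI)
    fix W' assume W': "W' \<in> \<W>"
    show "real_of_int (b W') \<le> (\<Sum>i\<in>W'. x $ i)"
    proof (cases "W' = W")
      case True
      have "(\<Sum>i\<in>W. x $ i) = (\<Sum>i\<in>T. x $ i) + (\<Sum>i\<in>U. x $ i)"
        using T(1) by (simp add: U_def sum.subset_diff add.commute)
      also have "(\<Sum>i\<in>T. x $ i) = (\<Sum>i\<in>T. 1)"
        by (intro sum.cong) (auto simp: x_def U_def)
      also have "(\<Sum>i\<in>U. x $ i) = 1" using U0 by (simp add: x_def c_def)
      finally show ?thesis using True cT by simp
    next
      case False
      then have "W' \<inter> U = {}" using disj W W' by (auto simp: pairwise_def disjnt_def U_def)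
      then have "(\<Sum>i\<in>W'. x $ i) = (\<Sum>i\<in>W'. 1)" by (intro sum.cong) (auto simp: x_def)
      moreover have "b W' \<le> int (card W')" using b W' by blast
      ultimately show ?thesis by simp
    qed
  qed (use c in \<open>auto simp: x_def\<close>)
  \<comment> \<open>Going through a minimizer avoids a separate proof that the infimum is over a set
    bounded below.\<close>
  moreover obtain y where y: "is_arg_min (relaxed_cost l (\<lambda>_. ?f)) (\<lambda>x. x \<in> ?P) y"
    using relaxed_minimizer_exists[OF l _ compact_covering_polytope, of "\<lambda>_. ?f" \<W> b] f \<open>x \<in> ?P\<close>
    by blast
  ultimately have "relaxed_opt l (\<lambda>_. ?f) ?P \<le> relaxed_cost l (\<lambda>_. ?f) x"
    by (simp add: relaxed_opt_arg_min[OF y] is_arg_min_linorder)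
  also have "\<dots> \<le> c"
    unfolding relaxed_cost_le_iff[OF l] by (intro ballI lovasz_extension_hitting_le U0) (simp add: x_def)
  also have "c = 1 / real_of_int (int (card W) - b W + 1)"
    unfolding c_def cU[symmetric] by simp
  finally show ?thesis using f rob that by blast
qed

theorem theorem8:
  fixes f :: "nat \<Rightarrow> 'v::finite set \<Rightarrow> real"
    and l :: nat
    and C \<W> :: "'v set set"
    and b :: "'v set \<Rightarrow> int"
  assumes "1 \<le> l"
    and "\<forall>i\<in>{1..l}. normalized_mono_submodular (f i)"
    and "C \<noteq> {}"
    and "\<W> \<noteq> {}"
    and "\<forall>W\<in>\<W>. 1 \<le> b W \<and> b W \<le> int (card W)"
    and "expressed_through C (covering_polytope \<W> b)"
  shows "((\<exists>X. relaxation_scheme_output l f C (covering_polytope \<W> b) X) \<and>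
          (\<forall>X. relaxation_scheme_output l f C (covering_polytope \<W> b) X \<longrightarrow>
             X \<in> C \<and>
             robust_cost l f X \<le> real_of_int (approx_factor \<W> b) * robust_opt l f C)) \<and>
         (pairwise disjnt \<W> \<longrightarrow>
            integrality_gap l C (covering_polytope \<W> b) = ereal (real_of_int (approx_factor \<W> b)))"
proof -
  let ?P = "covering_polytope \<W> b"
  let ?\<alpha> = "real_of_int (approx_factor \<W> b)"
  note l = assms(1) and C = assms(3,6) and b = assms(4,5)
  have b': "\<forall>W\<in>\<W>. b W \<le> int (card W)" using b by blast
  have \<alpha>: "1 \<le> ?\<alpha>" using approx_factor_pos[OF b(1) b'] by simp
  have CP: "indicator_vec X \<in> ?P" if "X \<in> C" for X
    using that expressed_throughD[OF C(2)] by (auto simp: up_closure_def)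
  then have P: "compact ?P" "?P \<noteq> {}"
    using compact_covering_polytope C(1) by blast+
  have out: "\<exists>X. relaxation_scheme_output l g C ?P X"
    if "\<forall>i\<in>{1..l}. normalized_mono_submodular (g i)" for g
    by (rule relaxation_scheme_output_exists[OF l that C(1) P])
  have outC: "X \<in> C" if "relaxation_scheme_output l g C ?P X" for g X
    using that by (auto simp: relaxation_scheme_output_def)
  \<comment> \<open>Some run has an output; its cost is at least the discrete optimum and at most
    \<alpha> times the relaxed one.\<close>
  have opt: "robust_opt l g C \<le> ?\<alpha> * relaxed_opt l g ?P"
    if "\<forall>i\<in>{1..l}. normalized_mono_submodular (g i)" for g
    using out[OF that] relaxation_scheme_output_le_relaxed_opt[OF l that b(1) b' C(2)] outC
      robust_opt_le order.trans by blast
  have "robust_cost l f X \<le> ?\<alpha> * robust_opt l f C"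
    if "relaxation_scheme_output l f C ?P X" for X
  proof -
    have "robust_cost l f X \<le> ?\<alpha> * relaxed_opt l f ?P"
      by (rule relaxation_scheme_output_le_relaxed_opt[OF l assms(2) b(1) b' C(2) that])
    also have "\<dots> \<le> ?\<alpha> * robust_opt l f C"
      using \<alpha> relaxed_opt_le_robust_opt[OF l assms(2) C(1) P(1) CP] by (intro mult_left_mono) auto
    finally show ?thesis .
  qed
  moreover have "integrality_gap l C ?P = ereal ?\<alpha>" if disj: "pairwise disjnt \<W>"
    unfolding integrality_gap_def
  proof (rule antisym)
    show "(SUP g\<in>{g. (\<forall>i\<in>{1..l}. normalized_mono_submodular (g i)) \<and> 0 < relaxed_opt l g ?P}.
        ereal (robust_opt l g C / relaxed_opt l g ?P)) \<le> ereal ?\<alpha>"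
      by (intro SUP_least) (use opt in \<open>auto simp: pos_divide_le_eq\<close>)
    have "approx_factor \<W> b \<in> (\<lambda>W. int (card W) - b W + 1) ` \<W>"
      unfolding approx_factor_def using b(1) by (intro Max_in) auto
    then obtain W where W: "W \<in> \<W>" "approx_factor \<W> b = int (card W) - b W + 1" by blast
    \<comment> \<open>All \<open>l\<close> costs are taken equal to \<open>g\<close>, built from a
      \<open>W\<close> attaining the maximum in \<open>approx_factor\<close>.\<close>
    obtain g where g: "normalized_mono_submodular g" "1 \<le> robust_opt l (\<lambda>_. g) C"
      "relaxed_opt l (\<lambda>_. g) ?P \<le> 1 / ?\<alpha>"
      using integrality_gap_instance[OF l C b(2) disj W(1)] unfolding W(2) by blast
    have "0 < ?\<alpha> * relaxed_opt l (\<lambda>_. g) ?P" using opt[of "\<lambda>_. g"] g by simp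
    then have pos: "0 < relaxed_opt l (\<lambda>_. g) ?P" using \<alpha> by (simp add: zero_less_mult_iff)
    have "?\<alpha> * relaxed_opt l (\<lambda>_. g) ?P \<le> 1" using g(3) \<alpha> by (simp add: field_simps)
    then have "?\<alpha> \<le> robust_opt l (\<lambda>_. g) C / relaxed_opt l (\<lambda>_. g) ?P"
      using g(2) pos by (simp add: pos_le_divide_eq)
    then show "ereal ?\<alpha> \<le> (SUP g\<in>{g. (\<forall>i\<in>{1..l}. normalized_mono_submodular (g i)) \<and> 0 < relaxed_opt l g ?P}.
        ereal (robust_opt l g C / relaxed_opt l g ?P))"
      using g(1) pos by (intro SUP_upper2[of "\<lambda>_. g"]) auto
  qed
  ultimately show ?thesis using out[OF assms(2)] outC by blast
qed

end
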